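(* Let $(q_k)_{k\ge 1}$ be a sequence of positive integers with $q_{k+1}\ge q_k(q_k+1)$ for all $k\ge 1$, let $(\xi_k)_{k\ge1}$ be independent random variables with $\mathsf{P}\{\xi_k=0\}=p_{0k}$, $\mathsf{P}\{\xi_k=1\}=p_{1k}$, $p_{0k},p_{1k}\ge 0$, $p_{0k}+p_{1k}=1$, and let $$\xi=\sum_{k=1}^\infty \frac{(-1)^{k+1}\xi_k}{q_k}.$$ Let $f_\xi(t)=\mathsf{E}(e^{it\xi})$ and $L_\xi=\limsup_{|t|\to\infty}|f_\xi(t)|$. Then $L_\xi>0$. If moreover $$\liminf_{n\to\infty}\frac{\mathrm{lcm}(q_1,q_2,\dots,q_n)}{q_{n+1}}=0,$$ then $L_\xi=1$.
   Context: $\mathrm{lcm}(q_1,\dots,q_n)$ denotes the least common multiple of the positive integers $q_1,\dots,q_n$. *)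

theory Defs
  imports "HOL-Probability.Probability"
begin

(* The sum over k >= 1 of (-1)^(k+1) * X k / q k; the summation index is k - 1. *)
definition alternating_series_rv :: "(nat \<Rightarrow> nat) \<Rightarrow> (nat \<Rightarrow> 'a \<Rightarrow> real) \<Rightarrow> 'a \<Rightarrow> real" where
  "alternating_series_rv q X \<omega> =
     (\<Sum>j. (- 1) ^ (Suc j + 1) * X (Suc j) \<omega> / real (q (Suc j)))"

(* For a real variable, at_infinity is the filter |t| -> infinity; char N is the
   characteristic function of the distribution N. *)
definition char_limsup :: "'a measure \<Rightarrow> ('a \<Rightarrow> real) \<Rightarrow> ereal" where
  "char_limsup M Y = Limsup at_infinity (\<lambda>t::real. ereal (cmod (char (distr M borel Y) t)))"

end

theory Submission imports Defs begin

text \<open>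
  The characteristic function is examined at the points \<open>t\<^sub>n = 2 \<pi> L\<^sub>n\<close> with
  \<open>L\<^sub>n = lcm(q\<^sub>1, \<dots>, q\<^sub>n)\<close>. At such a point every one of the first \<open>n\<close> terms of the series
  contributes a multiple of \<open>2 \<pi>\<close> to the phase \<open>t\<^sub>n \<xi>\<close>, so that these terms disappear from
  \<open>exp (\<i> t\<^sub>n \<xi>)\<close>. The terms from index \<open>n + 2\<close> on contribute a phase of size at most
  \<open>4 \<pi> L\<^sub>n / q\<^bsub>n+2\<^esub>\<close>, because \<open>q\<close> at least doubles in every step. What remains is the term of
  index \<open>n + 1\<close>, whose phase is \<open>\<plusminus> 2 \<pi> r\<^sub>n\<close> or \<open>0\<close>, where \<open>r\<^sub>n = L\<^sub>n / q\<^bsub>n+1\<^esub>\<close>. A mixture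
  of the two phases \<open>0\<close> and \<open>c\<close> has modulus at least \<open>\<bar>cos (c / 2)\<bar>\<close> (the worst case being equal
  weights), and hence, by \<open>q\<^bsub>n+2\<^esub> \<ge> q\<^bsub>n+1\<^esub> (q\<^bsub>n+1\<^esub> + 1)\<close>,
  \<open>\<bar>f t\<^sub>n\<bar> \<ge> cos (\<pi> r\<^sub>n) - 4 \<pi> r\<^sub>n / (q\<^bsub>n+1\<^esub> + 1)\<close>. This is
  \<open>cmod_char_at_lcm_ge\<close>, and both claims follow from it. The growth condition forces
  \<open>r\<^sub>n \<le> 1/3\<close> for \<open>n \<ge> 2\<close> (\<open>three_lcm_le\<close>), so the lower bound is at least
  \<open>cos (\<pi> / 3) = 1/2\<close> up to an error that tends to \<open>0\<close>; and along a subsequence with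
  \<open>r\<^sub>n \<rightarrow> 0\<close> it tends to \<open>1\<close>. Since \<open>L\<^sub>n \<ge> n\<close>, the points \<open>t\<^sub>n\<close> tend to infinity.
\<close>

section \<open>Sequences with quadratic growth\<close>

context
  fixes q :: "nat \<Rightarrow> nat"
  assumes q_pos: "\<And>k. k \<ge> 1 \<Longrightarrow> q k > 0"
    and q_growth: "\<And>k. k \<ge> 1 \<Longrightarrow> q (k + 1) \<ge> q k * (q k + 1)"
begin

lemma index_le_q:
  assumes "n \<ge> 1"
  shows "n \<le> q n"
  using assms
proof (induction n rule: dec_induct)
  case base
  then show ?case using q_pos[of 1] by simp
next
  case (step n)
  have "n + 1 \<le> q n + 1" using step.IH by simp
  also have "\<dots> \<le> q n * (q n + 1)" using q_pos[of n] step.hyps by simp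
  also have "\<dots> \<le> q (n + 1)" using q_growth[of n] step.hyps by simp
  finally show ?case by simp
qed

lemma power2_mult_q_le:
  assumes "m \<ge> 1"
  shows "2 ^ j * q m \<le> q (m + j)"
proof (induction j)
  case (Suc j)
  have pos: "q (m + j) > 0" using q_pos assms by simp
  have "2 ^ Suc j * q m \<le> 2 * q (m + j)" using Suc by simp
  also have "\<dots> \<le> q (m + j) * (q (m + j) + 1)" using pos by simp
  also have "\<dots> \<le> q (m + Suc j)" using q_growth[of "m + j"] assms by simp
  finally show ?case .
qed simp

lemma lcm_pos: "(LCM k\<in>{1..n}. q k) > 0"
proof -
  have "(LCM k\<in>{1..n}. q k) \<noteq> 0"
    using q_pos by (subst Lcm_0_iff) (auto simp: image_iff)
  then show ?thesis by (rule neq0_conv[THEN iffD1])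
qed

lemma index_le_lcm: "n \<le> (LCM k\<in>{1..n}. q k)"
proof (cases "n \<ge> 1")
  case True
  then have "q n dvd (LCM k\<in>{1..n}. q k)" by (intro dvd_Lcm) auto
  then have "q n \<le> (LCM k\<in>{1..n}. q k)" using lcm_pos by (rule dvd_imp_le)
  then show ?thesis using index_le_q[OF True] by simp
qed simp

lemma lcm_Suc_le: "(LCM k\<in>{1..Suc n}. q k) \<le> q (Suc n) * (LCM k\<in>{1..n}. q k)"
proof -
  have "(LCM k\<in>{1..Suc n}. q k) = lcm (q (Suc n)) (LCM k\<in>{1..n}. q k)"
    by (simp add: atLeastAtMostSuc_conv)
  also have "\<dots> \<le> q (Suc n) * (LCM k\<in>{1..n}. q k)"
    by (rule dvd_imp_le) (use q_pos[of "Suc n"] lcm_pos[of n] in auto)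
  finally show ?thesis .
qed

text \<open>
  A ratio of \<open>1/2\<close> would allow the lower bound \<open>cos (\<pi> r\<^sub>n)\<close> to vanish; the constant \<open>3\<close> keeps
  it away from \<open>0\<close>. The condition \<open>n \<ge> 2\<close> cannot be dropped: \<open>q\<^sub>1 = 1\<close>, \<open>q\<^sub>2 = 2\<close> gives the
  ratio \<open>1/2\<close> for \<open>n = 1\<close>. Once the bound holds it propagates, since a further factor
  \<open>q\<^bsub>n+1\<^esub>\<close> in the least common multiple is outweighed by \<open>q\<^bsub>n+2\<^esub> \<ge> q\<^bsub>n+1\<^esub>\<^sup>2\<close>.
\<close>

lemma three_lcm_le:
  assumes "n \<ge> 2"
  shows "3 * (LCM k\<in>{1..n}. q k) \<le> q (n + 1)"
  using assms
proof (induction n rule: dec_induct)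
  case base
  have q2: "q 1 * (q 1 + 1) \<le> q 2" using q_growth[of 1] by (simp add: numeral_2_eq_2)
  have q3: "q 2 * (q 2 + 1) \<le> q 3" using q_growth[of 2] by simp
  (* 3 a \<le> a^2 + a + 1 is (a - 1)^2 \<ge> 0 *)
  have "0 \<le> (int (q 1) - 1)\<^sup>2" by simp
  then have "int (3 * q 1) \<le> int (q 1 * (q 1 + 1) + 1)"
    by (simp add: power2_eq_square algebra_simps)
  then have three_q1: "3 * q 1 \<le> q 2 + 1" using q2 by linarith
  have "(LCM k\<in>{1..2}. q k) \<le> q 2 * q 1"
    using lcm_Suc_le[of 1] by (simp add: numeral_2_eq_2)
  then have "3 * (LCM k\<in>{1..2}. q k) \<le> q 2 * (3 * q 1)" by simp
  also have "\<dots> \<le> q 2 * (q 2 + 1)" using three_q1 by (rule mult_le_mono2)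
  also have "\<dots> \<le> q 3" by (rule q3)
  finally show ?case by simp
next
  case (step n)
  have "3 * (LCM k\<in>{1..Suc n}. q k) \<le> q (n + 1) * (3 * (LCM k\<in>{1..n}. q k))"
    using lcm_Suc_le[of n] by simp
  also have "\<dots> \<le> q (n + 1) * (q (n + 1) + 1)"
    using step.IH by (intro mult_le_mono2) simp
  also have "\<dots> \<le> q (Suc n + 1)" using q_growth[of "n + 1"] by simp
  finally show ?case .
qed

text \<open>
  The doubling of \<open>q\<close> makes a tail with bounded coefficients at most twice its first term.
\<close>

lemma tail_bound:
  fixes c :: "nat \<Rightarrow> real"
  assumes "m \<ge> 1" and "\<And>j. \<bar>c j\<bar> \<le> 1"
  shows "summable (\<lambda>j. c j / real (q (m + j)))"
    and "\<bar>\<Sum>j. c j / real (q (m + j))\<bar> \<le> 2 / real (q m)"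
proof -
  have qm: "q m > 0" using q_pos assms by simp
  have le: "\<bar>c j / real (q (m + j))\<bar> \<le> (1/2) ^ j / real (q m)" for j
  proof -
    have "real (2 ^ j * q m) \<le> real (q (m + j))"
      by (subst of_nat_le_iff) (rule power2_mult_q_le[OF assms(1)])
    then have "\<bar>c j\<bar> / real (q (m + j)) \<le> 1 / (2 ^ j * real (q m))"
      using qm assms(2)[of j] by (intro frac_le) auto
    then show ?thesis by (simp add: power_one_over field_simps)
  qed
  have geom: "(\<lambda>j. (1/2) ^ j / real (q m)) sums (2 / real (q m))"
    using sums_divide[OF geometric_sums[of "1/2 :: real"], of "real (q m)"] by simp
  show "summable (\<lambda>j. c j / real (q (m + j)))"
    by (rule summable_comparison_test'[where N = 0, OF sums_summable[OF geom]])
      (use le in simp)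
  have abs_summable: "summable (\<lambda>j. \<bar>c j / real (q (m + j))\<bar>)"
    by (rule summable_comparison_test'[where N = 0, OF sums_summable[OF geom]])
      (use le in simp)
  have "\<bar>\<Sum>j. c j / real (q (m + j))\<bar> \<le> (\<Sum>j. \<bar>c j / real (q (m + j))\<bar>)"
    by (rule summable_rabs[OF abs_summable])
  also have "\<dots> \<le> 2 / real (q m)"
    by (rule suminf_le[OF le abs_summable sums_summable[OF geom],
          unfolded sums_unique[OF geom, symmetric]])
  finally show "\<bar>\<Sum>j. c j / real (q (m + j))\<bar> \<le> 2 / real (q m)" .
qed

section \<open>Phases at multiples of the least common multiple\<close>

lemma iexp_lcm_term:
  assumes "k \<in> {1..n}" and "x \<in> {0, 1}"
  shows "iexp (2 * pi * real (LCM k\<in>{1..n}. q k) * ((- 1) ^ (k + 1) * x / real (q k))) = 1"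
proof -
  have "q k dvd (LCM k\<in>{1..n}. q k)" using assms by (intro dvd_Lcm) auto
  then obtain d where d: "(LCM k\<in>{1..n}. q k) = q k * d" by (elim dvdE)
  have "q k > 0" using assms q_pos by simp
  (* the floor only turns x, which is 0 or 1, into an integer *)
  then have phase: "2 * pi * real (LCM k\<in>{1..n}. q k) * ((- 1) ^ (k + 1) * x / real (q k))
      = real_of_int ((- 1) ^ (k + 1) * \<lfloor>x\<rfloor> * int d) * (2 * pi)"
    unfolding d using assms(2) by auto
  have "iexp (real_of_int j * (2 * pi)) = 1" for j :: int
    using exp_integer_2pi[of "of_int j"] by (simp add: algebra_simps)
  then show ?thesis unfolding phase .
qed

text \<open>
  For one outcome \<open>x\<close> of the coefficients, the whole series may be replaced in the phase by its
  single term of index \<open>n + 1\<close>, here written as the summand with \<open>j = n\<close>.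
\<close>

lemma iexp_series_at_lcm:
  fixes x :: "nat \<Rightarrow> real" and n :: nat
  assumes x: "\<And>k. k \<ge> 1 \<Longrightarrow> x k \<in> {0, 1}"
  defines "T \<equiv> 2 * pi * real (LCM k\<in>{1..n}. q k)"
  shows "cmod (iexp (T * (\<Sum>j. (- 1) ^ (Suc j + 1) * x (Suc j) / real (q (Suc j))))
      - iexp (T * ((- 1) ^ (Suc n + 1) / real (q (Suc n))) * x (Suc n)))
    \<le> 2 * T / real (q (n + 2))"
proof -
  define a where "a = (\<lambda>j. (- 1) ^ (Suc j + 1) * x (Suc j) / real (q (Suc j)))"
  define R where "R = (\<Sum>j. a (j + Suc n))"
  have coeff: "\<bar>(- 1) ^ (Suc j + 1) * x (Suc j)\<bar> \<le> 1" for j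
    using x[of "Suc j"] by (auto simp: abs_mult)
  have "summable (\<lambda>j. (- 1) ^ (Suc j + 1) * x (Suc j) / real (q (1 + j)))"
    by (rule tail_bound(1)[OF order_refl coeff])
  then have summable: "summable a" by (simp add: a_def)
  have "\<bar>\<Sum>j. (- 1) ^ (Suc (j + Suc n) + 1) * x (Suc (j + Suc n)) / real (q ((n + 2) + j))\<bar>
      \<le> 2 / real (q (n + 2))"
    by (rule tail_bound(2)[OF _ coeff]) simp
  then have R: "\<bar>R\<bar> \<le> 2 / real (q (n + 2))"
    by (simp add: R_def a_def add.commute)
  have T: "T \<ge> 0" by (simp add: T_def)
  have "suminf a = R + (\<Sum>j<n. a j) + a n"
    unfolding R_def by (subst suminf_split_initial_segment[OF summable, of "Suc n"]) simp
  then have "iexp (T * suminf a) = iexp (\<Sum>j<n. T * a j) * iexp (T * a n) * iexp (T * R)"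
    by (simp add: algebra_simps sum_distrib_left exp_add)
  also have "iexp (\<Sum>j<n. T * a j) = (\<Prod>j<n. iexp (T * a j))"
    by (simp add: sum_distrib_left exp_sum)
  also have "\<dots> = 1"
  proof (intro prod.neutral ballI)
    fix j assume "j \<in> {..<n}"
    then show "iexp (T * a j) = 1"
      unfolding a_def T_def by (intro iexp_lcm_term x) auto
  qed
  finally have "iexp (T * suminf a) - iexp (T * a n) = iexp (T * a n) * (iexp (T * R) - 1)"
    by (simp add: algebra_simps)
  then have "cmod (iexp (T * suminf a) - iexp (T * a n)) = cmod (iexp (T * R) - 1)"
    by (simp add: norm_mult)
  also have "\<dots> \<le> \<bar>T * R\<bar>" using iexp_approx1[of "T * R" 0] by simp
  also have "\<dots> \<le> T * (2 / real (q (n + 2)))"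
    unfolding abs_mult abs_of_nonneg[OF T] using R T by (rule mult_left_mono)
  finally show ?thesis by (simp add: a_def mult_ac)
qed

end

section \<open>Two-point distributions\<close>

text \<open>
  The squared modulus is \<open>1 - 2 p\<^sub>0 p\<^sub>1 (1 - cos c)\<close>, which is smallest for
  \<open>p\<^sub>0 = p\<^sub>1 = 1/2\<close>. By the half-angle identity its excess over \<open>(cos (c / 2))\<^sup>2\<close> is
  \<open>((p\<^sub>0 - p\<^sub>1) sin (c / 2))\<^sup>2\<close>.
\<close>

lemma cmod_two_point_ge:
  assumes "p0 + p1 = (1::real)"
  shows "cos (c / 2) \<le> cmod (of_real p0 + of_real p1 * iexp c)"
proof (rule power2_le_imp_le)
  define u v where "u = cos (c / 2)" and "v = sin (c / 2)"
  have uv: "u\<^sup>2 + v\<^sup>2 = 1" by (simp add: u_def v_def)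
  have c: "cos c = 2 * u\<^sup>2 - 1" using cos_double_cos[of "c / 2"] by (simp add: u_def)
  have p0: "p0 = 1 - p1" using assms by simp
  have "(cmod (of_real p0 + of_real p1 * iexp c))\<^sup>2 = (p0 + p1 * cos c)\<^sup>2 + (p1 * sin c)\<^sup>2"
    by (simp add: cmod_power2 Re_exp Im_exp)
  also have "\<dots> = p0\<^sup>2 + 2 * p0 * p1 * cos c + p1\<^sup>2 * ((sin c)\<^sup>2 + (cos c)\<^sup>2)"
    by algebra
  also have "\<dots> = p0\<^sup>2 + 2 * p0 * p1 * cos c + p1\<^sup>2" by simp
  also have "\<dots> = u\<^sup>2 + ((p0 - p1) * v)\<^sup>2"
    using uv unfolding c p0 by algebra
  finally show "(cos (c / 2))\<^sup>2 \<le> (cmod (of_real p0 + of_real p1 * iexp c))\<^sup>2"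
    by (simp add: u_def)
qed simp

context prob_space
begin

lemma AE_two_point:
  fixes X :: "'a \<Rightarrow> real"
  assumes [measurable]: "random_variable borel X"
    and "prob {\<omega> \<in> space M. X \<omega> = 0} + prob {\<omega> \<in> space M. X \<omega> = 1} = 1"
  shows "AE \<omega> in M. X \<omega> \<in> {0, 1}"
proof -
  have "prob ({\<omega> \<in> space M. X \<omega> = 0} \<union> {\<omega> \<in> space M. X \<omega> = 1})
      = prob {\<omega> \<in> space M. X \<omega> = 0} + prob {\<omega> \<in> space M. X \<omega> = 1}"
    by (rule finite_measure_Union) auto
  then have "AE \<omega> in M. \<omega> \<in> {\<omega> \<in> space M. X \<omega> = 0} \<union> {\<omega> \<in> space M. X \<omega> = 1}"
    using assms(2) by (intro AE_prob_1) simp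
  then show ?thesis by eventually_elim auto
qed

lemma expectation_iexp_two_point:
  fixes X :: "'a \<Rightarrow> real"
  assumes [measurable]: "random_variable borel X"
    and "prob {\<omega> \<in> space M. X \<omega> = 0} = p0" "prob {\<omega> \<in> space M. X \<omega> = 1} = p1"
    and "p0 + p1 = 1"
  shows "(CLINT \<omega>|M. iexp (c * X \<omega>)) = of_real p0 + of_real p1 * iexp c"
proof -
  let ?A = "{\<omega> \<in> space M. X \<omega> = 0}" and ?B = "{\<omega> \<in> space M. X \<omega> = 1}"
  have "AE \<omega> in M. iexp (c * X \<omega>) = indicator ?A \<omega> *\<^sub>R 1 + indicator ?B \<omega> *\<^sub>R iexp c"
    using AE_two_point[OF assms(1)] AE_space assms(2-4)
    by (auto simp: indicator_def elim: eventually_elim2)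
  then have "(CLINT \<omega>|M. iexp (c * X \<omega>))
      = (CLINT \<omega>|M. indicator ?A \<omega> *\<^sub>R 1 + indicator ?B \<omega> *\<^sub>R iexp c)"
    by (intro integral_cong_AE) auto
  also have "\<dots> = (CLINT \<omega>|M. indicator ?A \<omega> *\<^sub>R 1) + (CLINT \<omega>|M. indicator ?B \<omega> *\<^sub>R iexp c)"
    by (intro Bochner_Integration.integral_add integrable_scaleR_left)
      (auto simp: integrable_indicator_iff emeasure_eq_measure)
  also have "\<dots> = of_real p0 + of_real p1 * iexp c"
    using assms(2,3)
    by (simp add: emeasure_eq_measure scaleR_conv_of_real)
  finally show ?thesis .
qed

section \<open>The characteristic function at the least common multiples\<close>

lemma random_variable_alternating_series:
  assumes "\<And>k. k \<ge> 1 \<Longrightarrow> random_variable borel (X k)"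
  shows "random_variable borel (alternating_series_rv q X)"
proof -
  have [measurable]: "random_variable borel (X (Suc j))" for j
    using assms by simp
  show ?thesis unfolding alternating_series_rv_def[abs_def] by measurable
qed

lemma cmod_char_at_lcm_ge:
  fixes X :: "nat \<Rightarrow> 'a \<Rightarrow> real"
  assumes q_pos: "\<And>k. k \<ge> 1 \<Longrightarrow> q k > 0"
    and q_growth: "\<And>k. k \<ge> 1 \<Longrightarrow> q (k + 1) \<ge> q k * (q k + 1)"
    and rv: "\<And>k. k \<ge> 1 \<Longrightarrow> random_variable borel (X k)"
    and p: "\<And>k. k \<ge> 1 \<Longrightarrow>
      prob {\<omega> \<in> space M. X k \<omega> = 0} + prob {\<omega> \<in> space M. X k \<omega> = 1} = 1"
  defines "L \<equiv> \<lambda>n. real (LCM k\<in>{1..n}. q k)"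
  shows "cos (pi * (L n / real (q (n + 1))))
        - 4 * pi * (L n / real (q (n + 1))) / (real (q (n + 1)) + 1)
      \<le> cmod (char (distr M borel (alternating_series_rv q X)) (2 * pi * L n))"
proof -
  let ?Y = "alternating_series_rv q X"
  define T where "T = 2 * pi * L n"
  define c where "c = T * ((- 1) ^ (Suc n + 1) / real (q (Suc n)))"
  have [measurable]: "random_variable borel ?Y"
    using rv by (rule random_variable_alternating_series)
  have [measurable]: "random_variable borel (X (Suc n))" using rv by simp
  have T: "T \<ge> 0" by (simp add: T_def L_def)
  have char: "char (distr M borel ?Y) T = (CLINT \<omega>|M. iexp (T * ?Y \<omega>))"
    by (simp add: char_def integral_distr)
  have "AE \<omega> in M. \<forall>j. X (Suc j) \<omega> \<in> {0, 1}"
    by (subst AE_all_countable) (intro allI AE_two_point rv p; simp)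
  then have close: "AE \<omega> in M. cmod (iexp (T * ?Y \<omega>) - iexp (c * X (Suc n) \<omega>))
      \<le> 2 * T / real (q (n + 2))"
  proof eventually_elim
    case (elim \<omega>)
    have "X k \<omega> \<in> {0, 1}" if "k \<ge> 1" for k
      using elim that by (cases k) auto
    from iexp_series_at_lcm[where q = q and x = "\<lambda>k. X k \<omega>" and n = n, OF q_pos q_growth this]
    show ?case
      unfolding alternating_series_rv_def T_def c_def L_def .
  qed
  have int1: "integrable M (\<lambda>\<omega>. iexp (T * ?Y \<omega>))"
    by (rule integrable_const_bound[of _ 1]) auto
  have int2: "integrable M (\<lambda>\<omega>. iexp (c * X (Suc n) \<omega>))"
    by (rule integrable_const_bound[of _ 1]) auto
  have "cmod (char (distr M borel ?Y) T - (CLINT \<omega>|M. iexp (c * X (Suc n) \<omega>)))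
      = cmod (CLINT \<omega>|M. iexp (T * ?Y \<omega>) - iexp (c * X (Suc n) \<omega>))"
    unfolding char by (subst Bochner_Integration.integral_diff[OF int1 int2]) simp
  also have "\<dots> \<le> (LINT \<omega>|M. cmod (iexp (T * ?Y \<omega>) - iexp (c * X (Suc n) \<omega>)))"
    by (rule integral_norm_bound)
  also have "\<dots> \<le> 2 * T / real (q (n + 2))"
    by (rule integral_le_const[OF _ close])
      (intro integrable_norm Bochner_Integration.integrable_diff int1 int2)
  also have "\<dots> \<le> 2 * T / real (q (n + 1) * (q (n + 1) + 1))"
    using q_growth[of "n + 1"] q_pos[of "n + 1"] T
    by (intro divide_left_mono) (auto simp del: of_nat_mult intro!: mult_pos_pos)
  also have "\<dots> = 4 * pi * (L n / real (q (n + 1))) / (real (q (n + 1)) + 1)"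
    by (simp add: T_def distrib_left distrib_right add.commute)
  finally have "cmod (CLINT \<omega>|M. iexp (c * X (Suc n) \<omega>))
      - 4 * pi * (L n / real (q (n + 1))) / (real (q (n + 1)) + 1)
    \<le> cmod (char (distr M borel ?Y) T)"
    using norm_triangle_ineq2[of "CLINT \<omega>|M. iexp (c * X (Suc n) \<omega>)"
        "char (distr M borel ?Y) T"]
    by (simp add: norm_minus_commute)
  moreover have "cos (pi * (L n / real (q (n + 1))))
      \<le> cmod (CLINT \<omega>|M. iexp (c * X (Suc n) \<omega>))"
  proof -
    have "c / 2 = (- 1) ^ (Suc n + 1) * (pi * (L n / real (q (n + 1))))"
      by (simp add: c_def T_def)
    (* the alternating sign is absorbed because cos is even *)
    then have "cos (c / 2) = cos (pi * (L n / real (q (n + 1))))"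
      by (cases "even n") auto
    moreover have "(CLINT \<omega>|M. iexp (c * X (Suc n) \<omega>))
        = of_real (prob {\<omega> \<in> space M. X (Suc n) \<omega> = 0})
        + of_real (prob {\<omega> \<in> space M. X (Suc n) \<omega> = 1}) * iexp c"
      by (rule expectation_iexp_two_point) (simp_all add: p)
    ultimately show ?thesis
      using cmod_two_point_ge[OF p[of "Suc n"], of c] by simp
  qed
  ultimately show ?thesis by (simp add: T_def)
qed

end

section \<open>The upper limit\<close>

lemma le_Limsup_compose:
  fixes g :: "'b \<Rightarrow> ereal"
  assumes lim: "filterlim T F sequentially"
    and freq: "\<And>y. y < C \<Longrightarrow> \<exists>\<^sub>F n in sequentially. y < g (T n)"
  shows "C \<le> Limsup F g"
proof (rule ccontr)
  assume "\<not> C \<le> Limsup F g"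
  then obtain y where y: "Limsup F g < y" "y < C"
    unfolding not_le by (blast dest: dense)
  have "\<forall>\<^sub>F x in F. g x < y" using y(1) by (rule Limsup_lessD)
  then have "\<forall>\<^sub>F n in sequentially. g (T n) < y"
    using lim by (rule eventually_compose_filterlim)
  then have "\<forall>\<^sub>F n in sequentially. \<not> y < g (T n)"
    by eventually_elim simp
  then show False using freq[OF y(2)] by (simp add: frequently_def)
qed

lemma frequently_less_of_liminf:
  fixes r :: "nat \<Rightarrow> real"
  assumes "liminf (\<lambda>n. ereal (r n)) = 0" and "e > 0"
  shows "\<exists>\<^sub>F n in sequentially. r n < e"
  unfolding frequently_def
proof
  assume "\<forall>\<^sub>F n in sequentially. \<not> r n < e"
  then have "ereal e \<le> liminf (\<lambda>n. ereal (r n))"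
    by (intro Liminf_bounded) (auto elim: eventually_mono)
  then show False using assms by simp
qed

theorem corollary3:
  fixes M :: "'a measure"
    and q :: "nat \<Rightarrow> nat"
    and X :: "nat \<Rightarrow> 'a \<Rightarrow> real"
    and p0 p1 :: "nat \<Rightarrow> real"
  assumes "prob_space M"
    and "\<And>k. k \<ge> 1 \<Longrightarrow> q k > 0"
    and "\<And>k. k \<ge> 1 \<Longrightarrow> q (k + 1) \<ge> q k * (q k + 1)"
    and "prob_space.indep_vars M (\<lambda>_. borel) X {1..}"
    and "\<And>k. k \<ge> 1 \<Longrightarrow> measure M {\<omega> \<in> space M. X k \<omega> = 0} = p0 k"
    and "\<And>k. k \<ge> 1 \<Longrightarrow> measure M {\<omega> \<in> space M. X k \<omega> = 1} = p1 k"
    and "\<And>k. k \<ge> 1 \<Longrightarrow> p0 k \<ge> 0 \<and> p1 k \<ge> 0 \<and> p0 k + p1 k = 1"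
  shows "char_limsup M (alternating_series_rv q X) > 0 \<and>
    (liminf (\<lambda>n. ereal (real (LCM k\<in>{1..n}. q k) / real (q (n + 1)))) = 0 \<longrightarrow>
      char_limsup M (alternating_series_rv q X) = 1)"
proof -
  interpret prob_space M by fact
  define L where "L = (\<lambda>n. real (LCM k\<in>{1..n}. q k))"
  define r where "r = (\<lambda>n. L n / real (q (n + 1)))"
  define T where "T = (\<lambda>n. 2 * pi * L n)"
  define g where "g = (\<lambda>t. cmod (char (distr M borel (alternating_series_rv q X)) t))"
  have limsup_eq: "char_limsup M (alternating_series_rv q X) = Limsup at_infinity (\<lambda>t. ereal (g t))"
    by (simp add: char_limsup_def g_def)
  have rv: "random_variable borel (X k)" if "k \<ge> 1" for k
    using assms(4) that by (auto simp: indep_vars_def)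
  have r_nonneg: "r n \<ge> 0" for n by (simp add: r_def L_def)
  have g_ge: "cos (pi * r n) - 4 * pi * r n / (real (q (n + 1)) + 1) \<le> g (T n)" for n
    unfolding g_def T_def r_def L_def
    by (rule cmod_char_at_lcm_ge[where q = q and X = X, OF assms(2,3) rv])
      (simp_all add: assms(5-7))
  have L_ge: "real n \<le> L n" for n
    unfolding L_def by (subst of_nat_le_iff) (rule index_le_lcm[where q = q, OF assms(2,3)])
  have "filterlim T at_top sequentially"
  proof (rule filterlim_at_top_mono[OF filterlim_real_sequentially always_eventually, rule_format])
    fix n
    have "1 * real n \<le> 2 * pi * L n"
      using L_ge[of n] pi_ge_two by (intro mult_mono) auto
    then show "real n \<le> T n" by (simp add: T_def)
  qed
  then have T_lim: "filterlim T at_infinity sequentially"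
    by (rule filterlim_at_top_imp_at_infinity)
  (* any constant below cos (pi / 3) = 1/2 leaves room for the error term *)
  have "ereal (1/4) \<le> Limsup at_infinity (\<lambda>t. ereal (g t))"
  proof (rule le_Limsup_compose[OF T_lim])
    fix y :: ereal assume y: "y < ereal (1/4)"
    have "(\<lambda>n. 4 * pi * (1/3) / real (n + 1)) \<longlonglongrightarrow> 0"
      by (intro real_tendsto_divide_at_top[OF tendsto_const]
          filterlim_compose[OF filterlim_real_sequentially] filterlim_add_const_nat_at_top)
    then have "\<forall>\<^sub>F n in sequentially. 4 * pi * (1/3) / real (n + 1) < 1/4"
      by (rule order_tendstoD) simp
    then have "\<forall>\<^sub>F n in sequentially. y < ereal (g (T n))"
      using eventually_ge_at_top[of 2]
    proof eventually_elim
      case (elim n)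
      have "3 * (LCM k\<in>{1..n}. q k) \<le> q (n + 1)"
        using three_lcm_le[where q = q, OF assms(2,3) elim(2)] .
      then have "real (3 * (LCM k\<in>{1..n}. q k)) \<le> real (q (n + 1))"
        by (subst of_nat_le_iff)
      then have r_le: "r n \<le> 1/3"
        using assms(2)[of "n + 1"] by (simp add: r_def L_def field_simps)
      have "pi * r n \<le> pi / 3" using mult_left_mono[OF r_le, of pi] by simp
      then have "cos (pi / 3) \<le> cos (pi * r n)"
        using r_nonneg by (intro cos_monotone_0_pi_le) auto
      moreover have "n + 1 \<le> q (n + 1)" by (rule index_le_q[where q = q, OF assms(2,3)]) simp_all
      then have "4 * pi * r n / (real (q (n + 1)) + 1) \<le> 4 * pi * (1/3) / real (n + 1)"
        using r_le r_nonneg by (intro frac_le mult_left_mono) auto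
      ultimately have "1/4 \<le> g (T n)"
        using g_ge[of n] elim(1) unfolding cos_60 by linarith
      then show ?case using y by (meson ereal_less_eq(3) less_le_trans)
    qed
    then show "\<exists>\<^sub>F n in sequentially. y < ereal (g (T n))"
      by (rule eventually_frequently[rotated]) simp
  qed
  then have pos: "Limsup at_infinity (\<lambda>t. ereal (g t)) > 0"
    by (rule less_le_trans[rotated]) simp
  have le1: "Limsup at_infinity (\<lambda>t. ereal (g t)) \<le> 1"
  proof (intro Limsup_bounded always_eventually allI)
    fix t
    interpret Y: prob_space "distr M borel (alternating_series_rv q X)"
      by (intro prob_space_distr random_variable_alternating_series rv)
    interpret Y: real_distribution "distr M borel (alternating_series_rv q X)"
      by unfold_locales simp_all
    show "ereal (g t) \<le> 1" unfolding g_def using Y.cmod_char_le_1 by simp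
  qed
  have ge1: "1 \<le> Limsup at_infinity (\<lambda>t. ereal (g t))"
    if liminf0: "liminf (\<lambda>n. ereal (r n)) = 0"
  proof (rule le_Limsup_compose[OF T_lim])
    fix y :: ereal assume "y < 1"
    then obtain z where z: "y \<le> ereal z" "z < 1"
      by (cases y) (auto intro: that[of 0])
    have "((\<lambda>s. cos (pi * s) - 4 * pi * s) \<longlongrightarrow> cos (pi * 0) - 4 * pi * 0) (at_right (0::real))"
      by (intro tendsto_intros)
    then have "\<forall>\<^sub>F s in at_right (0::real). z < cos (pi * s) - 4 * pi * s"
      using z(2) by (intro order_tendstoD) simp_all
    then obtain e where e: "e > 0" "\<And>s. 0 < s \<Longrightarrow> s < e \<Longrightarrow> z < cos (pi * s) - 4 * pi * s"
      by (auto simp: eventually_at_right_field)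
    show "\<exists>\<^sub>F n in sequentially. y < ereal (g (T n))"
    proof (rule frequently_elim1[OF frequently_less_of_liminf[OF liminf0 e(1)]])
      fix n assume "r n < e"
      have "L n > 0" using lcm_pos[where q = q and n = n, OF assms(2,3)] by (simp add: L_def)
      then have "r n > 0" using assms(2)[of "n + 1"] by (simp add: r_def)
      then have "z < cos (pi * r n) - 4 * pi * r n" using e(2) \<open>r n < e\<close> by simp
      also have "\<dots> \<le> cos (pi * r n) - 4 * pi * r n / (real (q (n + 1)) + 1)"
        using frac_le[of "4 * pi * r n" "4 * pi * r n" 1 "real (q (n + 1)) + 1"] r_nonneg[of n]
        by simp
      also have "\<dots> \<le> g (T n)" by (rule g_ge)
      finally show "y < ereal (g (T n))" using z(1) by (simp add: le_less_trans)
    qed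
  qed
  show ?thesis
    unfolding limsup_eq using pos le1 ge1 by (auto simp: r_def L_def intro: antisym)
qed

end
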